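(* Let $H$ be the division ring of real quaternions with standard units $i,j,k$ and conjugation $\overline{x}=x^0-x^1i-x^2j-x^3k$ for $x=x^0+x^1i+x^2j+x^3k$. The map $f:H\to H$, $f(x)=\overline{x}$, has at every point $x$ the Gâteaux derivative $$\partial(\overline{x})(h)=-\tfrac12\,(h+ihi+jhj+khk)\qquad\text{for all }h\in H .$$
   Context: $H$ carries the norm $|x|=\sqrt{x\overline{x}}$, with $i^2=j^2=k^2=-1$, $ij=k=-ji$, $jk=i=-kj$, $ki=j=-ik$. The Gâteaux derivative of $f$ at $x$ is the $\mathbb R$-linear map $\partial f(x):H\to H$ with $f(x+h)-f(x)=\partial f(x)(h)+o(h)$, $o$ continuous and $\lim_{h\to0}|o(h)|/|h|=0$. *)

theory Defs
  imports "HOL-Analysis.Analysis"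
begin

section \<open>The division ring of real quaternions\<close>

text \<open>\<open>Quat a b c d\<close> stands for $a + bi + cj + dk$.\<close>

datatype quat = Quat (qRe: real) (qIm1: real) (qIm2: real) (qIm3: real)

lemma quat_eq_iff:
  "x = y \<longleftrightarrow> qRe x = qRe y \<and> qIm1 x = qIm1 y \<and> qIm2 x = qIm2 y \<and> qIm3 x = qIm3 y"
  by (cases x; cases y) simp

definition qi :: quat where "qi = Quat 0 1 0 0"
definition qj :: quat where "qj = Quat 0 0 1 0"
definition qk :: quat where "qk = Quat 0 0 0 1"

definition qcnj :: "quat \<Rightarrow> quat"
  where "qcnj x = Quat (qRe x) (- qIm1 x) (- qIm2 x) (- qIm3 x)"

instantiation quat :: real_vector
begin

definition zero_quat :: quat
  where "0 = Quat 0 0 0 0"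

definition plus_quat :: "quat \<Rightarrow> quat \<Rightarrow> quat"
  where "x + y = Quat (qRe x + qRe y) (qIm1 x + qIm1 y) (qIm2 x + qIm2 y) (qIm3 x + qIm3 y)"

definition uminus_quat :: "quat \<Rightarrow> quat"
  where "- x = Quat (- qRe x) (- qIm1 x) (- qIm2 x) (- qIm3 x)"

definition minus_quat :: "quat \<Rightarrow> quat \<Rightarrow> quat"
  where "x - y = Quat (qRe x - qRe y) (qIm1 x - qIm1 y) (qIm2 x - qIm2 y) (qIm3 x - qIm3 y)"

definition scaleR_quat :: "real \<Rightarrow> quat \<Rightarrow> quat"
  where "r *\<^sub>R x = Quat (r * qRe x) (r * qIm1 x) (r * qIm2 x) (r * qIm3 x)"

instance
  by standard
    (simp_all add: quat_eq_iff zero_quat_def plus_quat_def uminus_quat_def minus_quat_def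
      scaleR_quat_def algebra_simps)

end

text \<open>
  The product is the bilinear extension of $i^2 = j^2 = k^2 = -1$, $ij = k = -ji$,
  $jk = i = -kj$, $ki = j = -ik$; see \<open>quat_units\<close> below. The norm is
  $|x| = \sqrt{x \overline{x}}$, where $x \overline{x}$ is real by \<open>quat_mult_qcnj\<close>.
\<close>

instantiation quat :: real_normed_div_algebra
begin

definition one_quat :: quat
  where "1 = Quat 1 0 0 0"

definition times_quat :: "quat \<Rightarrow> quat \<Rightarrow> quat"
  where "x * y = Quat
    (qRe x * qRe y - qIm1 x * qIm1 y - qIm2 x * qIm2 y - qIm3 x * qIm3 y)
    (qRe x * qIm1 y + qIm1 x * qRe y + qIm2 x * qIm3 y - qIm3 x * qIm2 y)
    (qRe x * qIm2 y - qIm1 x * qIm3 y + qIm2 x * qRe y + qIm3 x * qIm1 y)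
    (qRe x * qIm3 y + qIm1 x * qIm2 y - qIm2 x * qIm1 y + qIm3 x * qRe y)"

definition norm_quat :: "quat \<Rightarrow> real"
  where "norm x = sqrt (qRe (x * qcnj x))"

definition inverse_quat :: "quat \<Rightarrow> quat"
  where "inverse x = inverse ((norm x)\<^sup>2) *\<^sub>R qcnj x"

definition divide_quat :: "quat \<Rightarrow> quat \<Rightarrow> quat"
  where "x div y = x * inverse (y :: quat)"

definition sgn_quat :: "quat \<Rightarrow> quat"
  where "sgn x = inverse (norm x) *\<^sub>R (x :: quat)"

definition dist_quat :: "quat \<Rightarrow> quat \<Rightarrow> real"
  where "dist x y = norm (x - y :: quat)"

definition uniformity_quat :: "(quat \<times> quat) filter"
  where "uniformity_quat = (INF e\<in>{0 <..}. principal {(x, y). dist x y < e})"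

definition open_quat :: "quat set \<Rightarrow> bool"
  where "open_quat U \<longleftrightarrow> (\<forall>x\<in>U. eventually (\<lambda>(x', y). x' = x \<longrightarrow> y \<in> U) uniformity)"

lemma norm_quat_sqrt:
  "norm x = sqrt ((qRe x)\<^sup>2 + (qIm1 x)\<^sup>2 + (qIm2 x)\<^sup>2 + (qIm3 x)\<^sup>2)" for x :: quat
  by (simp add: norm_quat_def times_quat_def qcnj_def power2_eq_square)

lemma norm_quat_prod: "norm x = norm ((qRe x, qIm1 x), (qIm2 x, qIm3 x))" for x :: quat
  by (simp add: norm_quat_sqrt norm_prod_def add.assoc)

instance
proof
  fix x y z :: quat and r s :: real
  note defs = quat_eq_iff zero_quat_def plus_quat_def scaleR_quat_def one_quat_def times_quat_def
  show "x * y * z = x * (y * z)" "(x + y) * z = x * z + y * z" "x * (y + z) = x * y + x * z"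
    "1 * x = x" "x * 1 = x" "(0::quat) \<noteq> 1" "r *\<^sub>R x * y = r *\<^sub>R (x * y)" "x * r *\<^sub>R y = r *\<^sub>R (x * y)"
    by (simp_all add: defs algebra_simps)
  have zero: "norm x = 0 \<longleftrightarrow> x = 0" for x :: quat
    unfolding norm_quat_prod by (simp add: quat_eq_iff zero_quat_def zero_prod_def)
  then show "norm x = 0 \<longleftrightarrow> x = 0" .
  have sq: "(norm x)\<^sup>2 = (qRe x)\<^sup>2 + (qIm1 x)\<^sup>2 + (qIm2 x)\<^sup>2 + (qIm3 x)\<^sup>2" for x :: quat
    by (simp add: norm_quat_sqrt)
  have cnj: "x * qcnj x = (norm x)\<^sup>2 *\<^sub>R 1" "qcnj x * x = (norm x)\<^sup>2 *\<^sub>R 1"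
    unfolding sq by (simp_all add: defs qcnj_def power2_eq_square)
  show "inverse x * x = 1" "x * inverse x = 1" if "x \<noteq> 0"
  proof -
    have nz: "(norm x)\<^sup>2 \<noteq> 0"
      using that zero by simp
    have "inverse x * x = inverse ((norm x)\<^sup>2) *\<^sub>R (qcnj x * x)"
      and "x * inverse x = inverse ((norm x)\<^sup>2) *\<^sub>R (x * qcnj x)"
      by (simp_all add: inverse_quat_def defs algebra_simps)
    then show "inverse x * x = 1" "x * inverse x = 1"
      using nz by (simp_all add: cnj)
  qed
  show "inverse (0 :: quat) = 0"
    by (simp add: inverse_quat_def defs qcnj_def)
  show "x div y = x * inverse y" by (rule divide_quat_def)
  show "sgn x = inverse (norm x) *\<^sub>R x" by (rule sgn_quat_def)
  show "dist x y = norm (x - y)" by (rule dist_quat_def)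
  show "(uniformity :: (quat \<times> quat) filter) = (INF e\<in>{0 <..}. principal {(x, y). dist x y < e})"
    by (rule uniformity_quat_def)
  show "open U \<longleftrightarrow> (\<forall>x\<in>U. eventually (\<lambda>(x', y). x' = x \<longrightarrow> y \<in> U) uniformity)" for U :: "quat set"
    by (rule open_quat_def)
  show "norm (x + y) \<le> norm x + norm y"
    using norm_triangle_ineq[of "((qRe x, qIm1 x), (qIm2 x, qIm3 x))" "((qRe y, qIm1 y), (qIm2 y, qIm3 y))"]
    by (simp add: norm_quat_prod plus_quat_def)
  have "norm (r *\<^sub>R x) = norm (r *\<^sub>R ((qRe x, qIm1 x), (qIm2 x, qIm3 x)))"
    by (simp add: norm_quat_prod scaleR_quat_def)
  also have "\<dots> = \<bar>r\<bar> * norm x"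
    by (simp only: norm_scaleR norm_quat_prod)
  finally show "norm (r *\<^sub>R x) = \<bar>r\<bar> * norm x" .
  have "(norm (x * y))\<^sup>2 = (norm x * norm y)\<^sup>2"
    unfolding power_mult_distrib sq by (simp add: times_quat_def power2_eq_square algebra_simps)
  moreover have "0 \<le> norm z" for z :: quat
    by (simp add: norm_quat_sqrt)
  ultimately show "norm (x * y) = norm x * norm y"
    by (simp add: power2_eq_iff_nonneg)
qed

end

lemma quat_mult_qcnj: "x * qcnj x = of_real ((norm x)\<^sup>2)"
  by (simp add: of_real_def norm_quat_sqrt quat_eq_iff times_quat_def qcnj_def scaleR_quat_def
      one_quat_def power2_eq_square)

lemma quat_units:
  "qi * qi = - 1" "qj * qj = - 1" "qk * qk = - 1"
  "qi * qj = qk" "qj * qi = - qk"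
  "qj * qk = qi" "qk * qj = - qi"
  "qk * qi = qj" "qi * qk = - qj"
  by (simp_all add: quat_eq_iff qi_def qj_def qk_def times_quat_def uminus_quat_def one_quat_def)

lemma quat_expand:
  "x = of_real (qRe x) + qIm1 x *\<^sub>R qi + qIm2 x *\<^sub>R qj + qIm3 x *\<^sub>R qk"
  by (simp add: of_real_def quat_eq_iff qi_def qj_def qk_def plus_quat_def scaleR_quat_def
      one_quat_def)

lemma qcnj_expand:
  "qcnj x = of_real (qRe x) - qIm1 x *\<^sub>R qi - qIm2 x *\<^sub>R qj - qIm3 x *\<^sub>R qk"
  by (simp add: of_real_def quat_eq_iff qi_def qj_def qk_def minus_quat_def scaleR_quat_def
      one_quat_def qcnj_def)

section \<open>Gateaux derivative\<close>

text \<open>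
  Continuity of the remainder \<open>r\<close> is required on the whole of $H$, not only at \<open>0\<close>, which makes
  this more restrictive than the library's \<open>has_derivative\<close>.
\<close>

definition has_gateaux_derivative :: "(quat \<Rightarrow> quat) \<Rightarrow> (quat \<Rightarrow> quat) \<Rightarrow> quat \<Rightarrow> bool"
  where "has_gateaux_derivative f D x \<longleftrightarrow>
    linear D \<and>
    (\<exists>r. continuous_on UNIV r \<and>
         (\<forall>h. f (x + h) - f x = D h + r h) \<and>
         ((\<lambda>h. norm (r h) / norm h) \<longlongrightarrow> 0) (at 0))"

lemma has_gateaux_derivative_unique:
  assumes "has_gateaux_derivative f D x" and "has_gateaux_derivative f D' x"
  shows "D = D'"
proof
  fix h
  obtain r where r: "\<And>h. f (x + h) - f x = D h + r h"
    and lim: "((\<lambda>h. norm (r h) / norm h) \<longlongrightarrow> 0) (at 0)" and D: "linear D"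
    using assms(1) unfolding has_gateaux_derivative_def by blast
  obtain r' where r': "\<And>h. f (x + h) - f x = D' h + r' h"
    and lim': "((\<lambda>h. norm (r' h) / norm h) \<longlongrightarrow> 0) (at 0)" and D': "linear D'"
    using assms(2) unfolding has_gateaux_derivative_def by blast
  show "D h = D' h"
  proof (cases "h = 0")
    case True
    then show ?thesis using D D' by (simp add: linear_0)
  next
    case False
    have path: "filterlim (\<lambda>t::real. t *\<^sub>R h) (at 0) (at 0)"
      unfolding filterlim_at
    proof
      show "\<forall>\<^sub>F t::real in at 0. t *\<^sub>R h \<in> UNIV \<and> t *\<^sub>R h \<noteq> 0"
        using False by (auto simp: eventually_at_filter)
      have "((\<lambda>t::real. t *\<^sub>R h) \<longlongrightarrow> 0 *\<^sub>R h) (at 0)"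
        by (intro tendsto_intros)
      then show "((\<lambda>t::real. t *\<^sub>R h) \<longlongrightarrow> 0) (at 0)" by simp
    qed
    let ?q = "\<lambda>h. norm (r h) / norm h + norm (r' h) / norm h"
    have "(?q \<longlongrightarrow> 0) (at 0)"
      using tendsto_add[OF lim lim'] by simp
    then have "((\<lambda>t::real. ?q (t *\<^sub>R h)) \<longlongrightarrow> 0) (at 0)"
      using path by (rule filterlim_compose)
    moreover have "norm (D h - D' h) / norm h \<le> ?q (t *\<^sub>R h)" if "t \<noteq> 0" for t :: real
    proof -
      have "D (t *\<^sub>R h) - D' (t *\<^sub>R h) = r' (t *\<^sub>R h) - r (t *\<^sub>R h)"
        using r[of "t *\<^sub>R h"] r'[of "t *\<^sub>R h"] by (simp add: algebra_simps)
      then have "t *\<^sub>R (D h - D' h) = r' (t *\<^sub>R h) - r (t *\<^sub>R h)"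
        using D D' by (simp add: linear_scale scaleR_diff_right)
      then have "\<bar>t\<bar> * norm (D h - D' h) \<le> norm (r (t *\<^sub>R h)) + norm (r' (t *\<^sub>R h))"
        by (metis norm_scaleR norm_triangle_ineq4 add.commute)
      then have "\<bar>t\<bar> * norm (D h - D' h) / norm (t *\<^sub>R h) \<le> ?q (t *\<^sub>R h)"
        by (metis add_divide_distrib divide_right_mono norm_ge_zero)
      then show ?thesis using that by simp
    qed
    then have "\<forall>\<^sub>F t::real in at 0. norm (D h - D' h) / norm h \<le> ?q (t *\<^sub>R h)"
      by (auto simp: eventually_at_filter)
    ultimately have "norm (D h - D' h) / norm h \<le> 0"
      by (intro tendsto_lowerbound) auto
    then show ?thesis using False by (simp add: divide_le_0_iff)
  qed
qed

end

theory Submission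
  imports Defs
begin

text \<open>
  Conjugation is \<open>\<real>\<close>-linear, so it is its own derivative at every point, with remainder zero
  (\<open>linear_has_gateaux_derivative\<close>). What has to be seen is that conjugation is the two-sided
  expression \<open>-(h + ihi + jhj + khk)/2\<close> (\<open>qcnj_eq_unit_sandwiches\<close>). For a unit \<open>u\<close> among
  \<open>i, j, k\<close> the map \<open>h \<mapsto> uhu\<close> negates \<open>1\<close> and \<open>u\<close>, which commute with \<open>u\<close>, and fixes the other
  two units, which anticommute with \<open>u\<close>; both because \<open>u\<^sup>2 = -1\<close>. In \<open>h + ihi + jhj + khk\<close>
  the real part therefore gets the factor \<open>1 - 3 = -2\<close>, and each imaginary part gets
  \<open>1 - 1 + 1 + 1 = 2\<close>.
\<close>

lemma qcnj_eq_unit_sandwiches: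
  "qcnj h = - (1 / 2) *\<^sub>R (h + qi * h * qi + qj * h * qj + qk * h * qk)"
  by (simp add: quat_eq_iff qcnj_def qi_def qj_def qk_def plus_quat_def times_quat_def
      scaleR_quat_def)

lemma linear_qcnj: "linear qcnj"
  by (rule linearI) (simp_all add: quat_eq_iff qcnj_def plus_quat_def scaleR_quat_def)

lemma linear_has_gateaux_derivative:
  assumes "linear D"
  shows "has_gateaux_derivative D D x"
  unfolding has_gateaux_derivative_def
  using assms by (intro conjI exI[of _ "\<lambda>_. 0"]) (simp_all add: linear_add)

theorem theorem7p4p2:
  fixes x :: quat
  shows "has_gateaux_derivative (\<lambda>y. qcnj y)
           (\<lambda>h. - (1 / 2) *\<^sub>R (h + qi * h * qi + qj * h * qj + qk * h * qk)) x"
  using linear_has_gateaux_derivative[OF linear_qcnj]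
  unfolding qcnj_eq_unit_sandwiches[symmetric] .

end
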